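(* Let $K$ be a field and let $n \geq 1$ be an integer. For $A \in GL(n,K)$ put $\sigma(A) = \mathrm{Tr}({}^t\!A\, A^{-1})$. Then $\sigma : GL(n,K) \to K$ is an invariant under congruence of nonsingular matrices, that is, for every $A \in GL(n,K)$ and every $P \in GL(n,K)$, $$\sigma({}^t\!P A P) = \sigma(A).$$
   Context: $GL(n,K)$ denotes the set of all $n\times n$ nonsingular matrices over $K$, ${}^t\!A$ denotes the transpose of $A$, and $\mathrm{Tr}$ denotes the trace. A map $h : GL(n,K) \to K$ is called an invariant under congruence of nonsingular matrices if for any $A \in GL(n,K)$, $h({}^t\!P A P) = h(A)$ holds for all $P \in GL(n,K)$. *)

theory Defs
  imports "HOL-Analysis.Analysis"
begin

definition GL :: "('k::field^'n^'n) set"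
  where "GL = {A. invertible A}"

(* Maps GL(n,K) -> K are represented by total functions on matrices; only their values
   on GL are constrained (congruence_closed_GL: both arguments of h lie in GL). *)
definition congruence_invariant :: "('k::field^'n^'n \<Rightarrow> 'k) \<Rightarrow> bool"
  where "congruence_invariant h \<longleftrightarrow>
    (\<forall>A \<in> GL. \<forall>P \<in> GL. h (transpose P ** A ** P) = h A)"

definition trace_transpose_inv :: "'k::field^'n^'n \<Rightarrow> 'k"
  where "trace_transpose_inv A = trace (transpose A ** matrix_inv A)"

lemma congruence_closed_GL:
  fixes A P :: "'k::field^'n^'n"
  assumes "A \<in> GL" and "P \<in> GL"
  shows "transpose P ** A ** P \<in> GL"
  using assms by (simp add: GL_def invertible_mult transpose_invertible invertible_det_nz det_mul)

end

theory Submission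
  imports Defs
begin

text \<open>Congruence acts on the matrix under the trace by similarity. With B and Q the inverses
  of A and P, the inverse of P^t A P is Q B Q^t, and its transpose is P^t A^t P. Their product
  collapses to P^t (A^t B) Q^t, a conjugate of A^t B because Q^t inverts P^t, so the traces
  agree.\<close>

text \<open>\<open>matrix_inv\<close> is a Hilbert choice of a two-sided inverse. Over a field a
  one-sided inverse of a square matrix is two-sided, and associativity makes it unique, so one
  product identifies the chosen value.\<close>

lemma matrix_inv_eqI:
  fixes A B :: "'k::field^'n^'n"
  assumes "A ** B = mat 1"
  shows "matrix_inv A = B"
proof -
  have BA: "B ** A = mat 1"
    using assms matrix_left_right_inverse by blast
  then have "invertible A"
    using assms unfolding invertible_def by blast
  then have "A ** matrix_inv A = mat 1"
    unfolding matrix_inv_def invertible_def by (rule someI2_ex) blast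
  then have "B ** A ** matrix_inv A = B"
    by (simp add: matrix_mul_assoc [symmetric])
  then show ?thesis
    by (simp add: BA)
qed

theorem mainTheorem1:
  shows "congruence_invariant (trace_transpose_inv :: 'k::field^'n^'n \<Rightarrow> 'k)"
  unfolding congruence_invariant_def
proof (intro ballI)
  fix A P :: "'k^'n^'n"
  assume "A \<in> GL" and "P \<in> GL"
  then obtain B Q where B: "A ** B = mat 1" and Q: "P ** Q = mat 1"
    unfolding GL_def invertible_def by blast
  \<comment> \<open>Transposition reverses products, so this is the transpose of
    \<open>Q ** P = mat 1\<close>, the other side of \<open>Q\<close>.\<close>
  have Q': "transpose P ** transpose Q = mat 1"
    using Q matrix_left_right_inverse by (metis matrix_transpose_mul transpose_mat)
  have "transpose P ** A ** P ** (Q ** B ** transpose Q)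
      = transpose P ** (A ** (P ** Q) ** B) ** transpose Q"
    by (simp only: matrix_mul_assoc)
  also have "\<dots> = mat 1"
    by (simp add: B Q Q')
  finally have inv: "matrix_inv (transpose P ** A ** P) = Q ** B ** transpose Q"
    by (rule matrix_inv_eqI)
  \<comment> \<open>The grouping isolates \<open>transpose P\<close> as the left factor, ready to be
    cycled to the end under the trace.\<close>
  have "transpose (transpose P ** A ** P) ** (Q ** B ** transpose Q)
      = transpose P ** (transpose A ** (P ** Q) ** B ** transpose Q)"
    by (simp add: matrix_transpose_mul transpose_transpose matrix_mul_assoc)
  then have "trace (transpose (transpose P ** A ** P) ** (Q ** B ** transpose Q))
      = trace (transpose A ** B ** transpose Q ** transpose P)"
    by (simp add: Q trace_mul_sym [of "transpose P"])
  also have "\<dots> = trace (transpose A ** B)"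
    using Q' matrix_left_right_inverse by (metis matrix_mul_assoc matrix_mul_rid)
  finally show "trace_transpose_inv (transpose P ** A ** P) = trace_transpose_inv A"
    by (simp add: trace_transpose_inv_def inv matrix_inv_eqI [OF B])
qed

end
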